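(* Let $n\ge 5$ be a prime such that the multiplicative group $\mathbb{Z}_n^*$ is generated by $\{-1,2\}$. Let $X_n$ be the $2$-dimensional simplicial complex on vertex set $\mathbb{Z}_n$ with full $1$-skeleton (all vertices and all edges) whose $2$-faces are exactly the arithmetic progressions $\{a,a+d,a+2d\}$ of length $3$ in $\mathbb{Z}_n$ with difference $d\notin\{0,\pm1\}$. Then: (1) $X_n$ is $2$-collapsible, and hence the set of its $2$-faces is an almost-hypertree over every field; (2) over $\mathbb{Q}$ the shadow of (the set of $2$-faces of) $X_n$ is empty. Consequently, the complement of the set of $2$-faces of $X_n$ in $\binom{\mathbb{Z}_n}{3}$ is a perfect hypercut over $\mathbb{Q}$.
   Context: For a field $\mathbb{F}$ and $d\ge1$, let $\partial_d$ be the $\binom{n}{d}\times\binom{n}{d+1}$ boundary matrix over $\mathbb{F}$ of the complete complex on $n$ vertices (columns indexed by oriented $d$-simplices, $\partial(v_0,\dots,v_d)=\sum_i(-1)^i(v_0,\dots,\hat v_i,\dots,v_d)$). The rank of a set $S$ of $d$-simplices is the $\mathbb{F}$-rank of the corresponding columns; $S$ is acyclic if its rank equals $|S|$. A $d$-hypertree is a maximal acyclic set of $d$-simplices (it has $\binom{n-1}{d}$ elements); an almost-hypertree is an acyclic set of size $\binom{n-1}{d}-1$. The shadow of $S$ is the set of $d$-simplices $\sigma\notin S$ with $\mathrm{rank}(S\cup\{\sigma\})=\mathrm{rank}(S)$. A $d$-hypercut is an inclusion-minimal set of $d$-simplices meeting every $d$-hypertree. A $2$-dimensional hypercut on $n$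 vertices is perfect if it has $\binom{n}{3}-\binom{n-1}{2}+1$ faces. A $(d-1)$-face of a $d$-complex is exposed if it lies in exactly one $d$-face; an elementary collapse removes an exposed $(d-1)$-face together with the unique $d$-face containing it; a $d$-complex is $d$-collapsible if all its $d$-faces can be removed by a sequence of elementary collapses. *)

theory Defs
  imports
    "HOL-Library.Function_Algebras"
    "HOL-Algebra.Generated_Groups"
    "HOL-Number_Theory.Residues"
begin

section \<open>Complexes and collapsing\<close>

text \<open>A complex is given by the set of its faces; a \<open>d\<close>-face has \<open>d + 1\<close> vertices. The empty
  face is allowed, and a \<open>(d - 1)\<close>-face below is a face with \<open>d\<close> vertices.\<close>

definition simplicial_complex :: "'v set set \<Rightarrow> bool" where
  "simplicial_complex K \<longleftrightarrow> (\<forall>\<sigma>\<in>K. finite \<sigma> \<and> (\<forall>\<tau>. \<tau> \<subseteq> \<sigma> \<longrightarrow> \<tau> \<in> K))"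

definition faces :: "nat \<Rightarrow> 'v set set \<Rightarrow> 'v set set" where
  "faces d K = {\<sigma> \<in> K. finite \<sigma> \<and> card \<sigma> = d + 1}"

definition exposed :: "nat \<Rightarrow> 'v set set \<Rightarrow> 'v set \<Rightarrow> bool" where
  "exposed d K \<tau> \<longleftrightarrow> \<tau> \<in> K \<and> finite \<tau> \<and> card \<tau> = d \<and> (\<exists>!\<sigma>. \<sigma> \<in> faces d K \<and> \<tau> \<subseteq> \<sigma>)"

definition elementary_collapse :: "nat \<Rightarrow> 'v set set \<Rightarrow> 'v set set \<Rightarrow> bool" where
  "elementary_collapse d K K' \<longleftrightarrow>
     (\<exists>\<tau> \<sigma>. exposed d K \<tau> \<and> \<sigma> \<in> faces d K \<and> \<tau> \<subseteq> \<sigma> \<and> K' = K - {\<tau>, \<sigma>})"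

definition collapsible :: "nat \<Rightarrow> 'v set set \<Rightarrow> bool" where
  "collapsible d K \<longleftrightarrow> (\<exists>K'. (elementary_collapse d)\<^sup>*\<^sup>* K K' \<and> faces d K' = {})"


section \<open>Boundary matrix and rank\<close>

definition simplices :: "nat \<Rightarrow> 'v set \<Rightarrow> 'v set set" where
  "simplices d V = faces d (Pow V)"

text \<open>Every simplex is oriented by the increasing order of its vertices, so that the vertex
  \<open>v\<close> of \<open>\<sigma>\<close> has position \<open>card {w \<in> \<sigma>. w < v}\<close>. The column of \<open>\<sigma>\<close> in the boundary matrix is
  regarded as a function on all sets; it vanishes outside the facets of \<open>\<sigma>\<close>.\<close>

definition boundary_column :: "'v::linorder set \<Rightarrow> 'v set \<Rightarrow> 'f::field" where
  "boundary_column \<sigma> \<tau> =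
     (\<Sum>v\<in>\<sigma>. if \<tau> = \<sigma> - {v} then (- 1) ^ card {w \<in> \<sigma>. w < v} else 0)"

definition chain_scale :: "'f::field \<Rightarrow> ('v set \<Rightarrow> 'f) \<Rightarrow> 'v set \<Rightarrow> 'f" where
  "chain_scale c x = (\<lambda>\<tau>. c * x \<tau>)"

interpretation chain: vector_space chain_scale
  by unfold_locales (auto simp: chain_scale_def fun_eq_iff algebra_simps)

definition simplex_rank :: "'f::field itself \<Rightarrow> 'v::linorder set set \<Rightarrow> nat" where
  "simplex_rank F S = chain.dim ((boundary_column :: 'v set \<Rightarrow> 'v set \<Rightarrow> 'f) ` S)"


section \<open>Hypertrees, shadows and hypercuts\<close>

text \<open>Below, \<open>F\<close> is the coefficient field, \<open>V\<close> the vertex set and \<open>d\<close> the dimension.\<close>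

definition acyclic_set :: "'f::field itself \<Rightarrow> 'v::linorder set \<Rightarrow> nat \<Rightarrow> 'v set set \<Rightarrow> bool" where
  "acyclic_set F V d S \<longleftrightarrow> S \<subseteq> simplices d V \<and> simplex_rank F S = card S"

definition hypertree :: "'f::field itself \<Rightarrow> 'v::linorder set \<Rightarrow> nat \<Rightarrow> 'v set set \<Rightarrow> bool" where
  "hypertree F V d T \<longleftrightarrow>
     acyclic_set F V d T \<and> (\<forall>S. acyclic_set F V d S \<and> T \<subseteq> S \<longrightarrow> S = T)"

definition almost_hypertree :: "'f::field itself \<Rightarrow> 'v::linorder set \<Rightarrow> nat \<Rightarrow> 'v set set \<Rightarrow> bool" where
  "almost_hypertree F V d S \<longleftrightarrow>
     acyclic_set F V d S \<and> card S + 1 = (card V - 1) choose d"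

definition shadow :: "'f::field itself \<Rightarrow> 'v::linorder set \<Rightarrow> nat \<Rightarrow> 'v set set \<Rightarrow> 'v set set" where
  "shadow F V d S =
     {\<sigma> \<in> simplices d V. \<sigma> \<notin> S \<and> simplex_rank F (insert \<sigma> S) = simplex_rank F S}"

definition meets_hypertrees ::
    "'f::field itself \<Rightarrow> 'v::linorder set \<Rightarrow> nat \<Rightarrow> 'v set set \<Rightarrow> bool" where
  "meets_hypertrees F V d C \<longleftrightarrow>
     C \<subseteq> simplices d V \<and> (\<forall>T. hypertree F V d T \<longrightarrow> C \<inter> T \<noteq> {})"

definition hypercut :: "'f::field itself \<Rightarrow> 'v::linorder set \<Rightarrow> nat \<Rightarrow> 'v set set \<Rightarrow> bool" where
  "hypercut F V d C \<longleftrightarrow>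
     meets_hypertrees F V d C \<and> (\<forall>D. D \<subset> C \<longrightarrow> \<not> meets_hypertrees F V d D)"

definition perfect_hypercut :: "'f::field itself \<Rightarrow> 'v::linorder set \<Rightarrow> 'v set set \<Rightarrow> bool" where
  "perfect_hypercut F V C \<longleftrightarrow>
     hypercut F V 2 C \<and> card C + ((card V - 1) choose 2) = (card V choose 3) + 1"


section \<open>The complex of arithmetic progressions\<close>

definition Zmod :: "nat \<Rightarrow> int ring" where
  "Zmod n = residue_ring (int n)"

definition AP_faces :: "nat \<Rightarrow> int set set" where
  "AP_faces n =
     {{a, a \<oplus>\<^bsub>Zmod n\<^esub> d, a \<oplus>\<^bsub>Zmod n\<^esub> d \<oplus>\<^bsub>Zmod n\<^esub> d} | a d.
        a \<in> carrier (Zmod n) \<and>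
        d \<in> carrier (Zmod n) - {\<zero>\<^bsub>Zmod n\<^esub>, \<one>\<^bsub>Zmod n\<^esub>, \<ominus>\<^bsub>Zmod n\<^esub> \<one>\<^bsub>Zmod n\<^esub>}}"

definition AP_complex :: "nat \<Rightarrow> int set set" where
  "AP_complex n = {\<sigma>. \<sigma> \<subseteq> carrier (Zmod n) \<and> card \<sigma> \<le> 2} \<union> AP_faces n"

lemma simplicial_complex_AP_complex:
  assumes "n > 0"
  shows "simplicial_complex (AP_complex n)"
proof -
  have fin: "finite (carrier (Zmod n))"
    by (simp add: Zmod_def residue_ring_def)
  have sub: "\<tau> \<in> AP_complex n" if "\<sigma> \<in> AP_faces n" "\<tau> \<subseteq> \<sigma>" for \<sigma> \<tau>
  proof (cases "\<tau> = \<sigma>")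
    case True
    with that show ?thesis by (simp add: AP_complex_def)
  next
    case False
    from that(1) obtain a b c where s: "\<sigma> = {a, b, c}" and car: "\<sigma> \<subseteq> carrier (Zmod n)"
      using assms by (fastforce simp: AP_faces_def Zmod_def residue_ring_def)
    have "card \<tau> < card \<sigma>"
      using False that(2) s by (intro psubset_card_mono) auto
    moreover have "card \<sigma> \<le> 3"
      unfolding s by (simp add: card_insert_if)
    ultimately show ?thesis
      using that(2) car by (auto simp: AP_complex_def)
  qed
  have "finite \<sigma>" if "\<sigma> \<in> AP_complex n" for \<sigma>
    using that fin by (auto simp: AP_complex_def AP_faces_def intro: finite_subset)
  moreover have "\<tau> \<in> AP_complex n" if "\<sigma> \<in> AP_complex n" "\<tau> \<subseteq> \<sigma>" for \<sigma> \<tau>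
  proof (cases "\<sigma> \<in> AP_faces n")
    case True
    with sub that(2) show ?thesis by blast
  next
    case False
    with that(1) have "\<sigma> \<subseteq> carrier (Zmod n)" "card \<sigma> \<le> 2"
      by (auto simp: AP_complex_def)
    moreover from this(1) fin that(2) have "card \<tau> \<le> card \<sigma>"
      by (intro card_mono) (auto intro: finite_subset)
    ultimately show ?thesis
      using that(2) by (auto simp: AP_complex_def)
  qed
  ultimately show ?thesis
    by (auto simp: simplicial_complex_def)
qed

end

theory Submission
  imports Defs
begin

text \<open>
  Since \<open>-1\<close> and \<open>2\<close> generate the units, every residue \<open>d \<noteq> 0\<close> is \<open>\<plusminus>2\<^sup>k\<close> for a least \<open>k > 0\<close>, the
  level of \<open>d\<close>; the level of \<open>2d\<close> exceeds that of \<open>d\<close> by one unless \<open>d = \<plusminus>1\<close>. The outer edge of a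
  progression of difference \<open>d\<close> has difference \<open>2d\<close>, and every other progression in the complex
  through it has difference \<open>\<plusminus>2d\<close>. Hence each face is free along its outer edge once all faces of
  higher level are gone, so the complex collapses, and its boundary columns are independent.

  Lifting \<open>d\<close> to the integer \<open>f(d) = \<plusminus>2\<^sup>k\<close> congruent to it (\<open>lift\<close> below) gives an odd function with
  \<open>f(2d) = 2 f(d)\<close> for \<open>d \<noteq> 0, \<plusminus>1\<close>. The functional on chains induced by \<open>(u, v) \<mapsto> f(v - u)\<close> maps the
  boundary of \<open>xyz\<close> to \<open>f(y - x) + f(z - y) + f(x - z)\<close>. This vanishes on all faces of the
  complex. Conversely three signed powers of two can only cancel as \<open>a + a - 2a\<close>, which
  forces \<open>x, y, z\<close> to be a progression of the complex in some order; so no other boundary lies in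
  the rational span.
\<close>

section \<open>Collapsing and rank\<close>

lemma faces_finite_card: "\<sigma> \<in> faces d K \<Longrightarrow> finite \<sigma> \<and> card \<sigma> = d + 1"
  by (simp add: faces_def)

lemma faces_Diff_facet:
  assumes "card \<tau> = d"
  shows "faces d (K - {\<tau>, \<sigma>}) = faces d K - {\<sigma>}"
  using assms by (auto simp: faces_def)

text \<open>A face of maximal level is the only face containing its chosen facet, so this pair can
  be collapsed. The hypothesis survives the removal, and induction on the number of faces
  finishes.\<close>

lemma collapsible_by_level:
  fixes lev :: "'v set \<Rightarrow> nat"
  assumes "finite (faces d K)"
    and "\<And>\<sigma>. \<sigma> \<in> faces d K \<Longrightarrow> \<exists>\<tau>\<in>K. card \<tau> = d \<and> \<tau> \<subseteq> \<sigma> \<and>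
           (\<forall>\<sigma>'\<in>faces d K. \<tau> \<subseteq> \<sigma>' \<longrightarrow> \<sigma>' \<noteq> \<sigma> \<longrightarrow> lev \<sigma> < lev \<sigma>')"
  shows "collapsible d K"
  using assms
proof (induction "card (faces d K)" arbitrary: K)
  case 0
  from 0(1,2) have "faces d K = {}" by simp
  then show ?case unfolding collapsible_def by blast
next
  case (Suc m)
  from Suc.hyps(2) have "faces d K \<noteq> {}" by auto
  then have "Max (lev ` faces d K) \<in> lev ` faces d K" using Suc.prems(1) by simp
  then obtain \<sigma> where \<sigma>: "\<sigma> \<in> faces d K" and lev_\<sigma>: "Max (lev ` faces d K) = lev \<sigma>"
    by (rule imageE)
  have max: "\<not> lev \<sigma> < lev \<sigma>'" if "\<sigma>' \<in> faces d K" for \<sigma>'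
    using Max_ge[OF finite_imageI[OF Suc.prems(1)] imageI[OF that, of lev]] unfolding lev_\<sigma>
    by (rule leD)
  obtain \<tau> where \<tau>: "\<tau> \<in> K" "card \<tau> = d" "\<tau> \<subseteq> \<sigma>"
    and up: "\<And>\<sigma>'. \<lbrakk>\<sigma>' \<in> faces d K; \<tau> \<subseteq> \<sigma>'; \<sigma>' \<noteq> \<sigma>\<rbrakk> \<Longrightarrow> lev \<sigma> < lev \<sigma>'"
    using Suc.prems(2)[OF \<sigma>] by metis
  have uniq: "\<sigma>' = \<sigma>" if "\<sigma>' \<in> faces d K" "\<tau> \<subseteq> \<sigma>'" for \<sigma>'
    using up max that by blast
  define K' where "K' = K - {\<tau>, \<sigma>}"
  have faces': "faces d K' = faces d K - {\<sigma>}"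
    using \<tau>(2) by (simp add: K'_def faces_Diff_facet)
  have "finite \<tau>" using \<sigma> \<tau>(3) by (meson faces_finite_card finite_subset)
  moreover have "\<exists>!\<rho>. \<rho> \<in> faces d K \<and> \<tau> \<subseteq> \<rho>"
    using \<sigma> \<tau>(3) uniq by (intro ex1I[of _ \<sigma>]) blast+
  ultimately have "exposed d K \<tau>"
    unfolding exposed_def using \<tau>(1,2) by blast
  then have "elementary_collapse d K K'"
    unfolding elementary_collapse_def K'_def using \<sigma> \<tau>(3) by blast
  moreover have "collapsible d K'"
  proof (rule Suc.hyps(1))
    show "m = card (faces d K')" using Suc.hyps(2) Suc.prems(1) \<sigma> faces' by simp
    show "finite (faces d K')" using Suc.prems(1) faces' by simp
    fix \<sigma>' assume \<sigma>': "\<sigma>' \<in> faces d K'"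
    then have in_K: "\<sigma>' \<in> faces d K" and "\<sigma>' \<noteq> \<sigma>" using faces' by simp_all
    from Suc.prems(2)[OF in_K] obtain \<tau>' where \<tau>': "\<tau>' \<in> K" "card \<tau>' = d" "\<tau>' \<subseteq> \<sigma>'"
      and up': "\<forall>\<rho>\<in>faces d K. \<tau>' \<subseteq> \<rho> \<longrightarrow> \<rho> \<noteq> \<sigma>' \<longrightarrow> lev \<sigma>' < lev \<rho>"
      by metis
    \<comment> \<open>Since \<open>\<tau>\<close> lies in no face but \<open>\<sigma>\<close>, and
      \<open>\<sigma>\<close> has one vertex too many, the facet chosen for \<open>\<sigma>'\<close>
      is still present in \<open>K'\<close>.\<close>
    have "\<tau>' \<noteq> \<tau>" using uniq[OF in_K] \<tau>'(3) \<open>\<sigma>' \<noteq> \<sigma>\<close> by metis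
    moreover have "\<tau>' \<noteq> \<sigma>" using faces_finite_card[OF \<sigma>] \<tau>'(2) by auto
    ultimately have "\<tau>' \<in> K'" using \<tau>'(1) by (simp add: K'_def)
    moreover have "\<forall>\<rho>\<in>faces d K'. \<tau>' \<subseteq> \<rho> \<longrightarrow> \<rho> \<noteq> \<sigma>' \<longrightarrow> lev \<sigma>' < lev \<rho>"
      using up' unfolding faces' by blast
    ultimately show "\<exists>\<tau>\<in>K'. card \<tau> = d \<and> \<tau> \<subseteq> \<sigma>' \<and>
           (\<forall>\<rho>\<in>faces d K'. \<tau> \<subseteq> \<rho> \<longrightarrow> \<rho> \<noteq> \<sigma>' \<longrightarrow> lev \<sigma>' < lev \<rho>)"
      using \<tau>'(2,3) by metis
  qed
  then obtain L where "(elementary_collapse d)\<^sup>*\<^sup>* K' L" "faces d L = {}"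
    by (auto simp: collapsible_def)
  ultimately show ?case
    unfolding collapsible_def using converse_rtranclp_into_rtranclp[of "elementary_collapse d"] by blast
qed

text \<open>A basis taken from the old columns stays independent when the new column joins it, and
  the enlarged basis spans all columns.\<close>

lemma simplex_rank_insert:
  fixes S :: "'v::linorder set set"
  assumes "finite S"
    and "(boundary_column \<sigma> :: 'v set \<Rightarrow> 'f::field) \<notin> chain.span (boundary_column ` S)"
  shows "simplex_rank TYPE('f) (insert \<sigma> S) = Suc (simplex_rank TYPE('f) S)"
proof -
  let ?c = "boundary_column :: 'v set \<Rightarrow> 'v set \<Rightarrow> 'f"
  obtain B where B: "B \<subseteq> ?c ` S" "chain.independent B" "?c ` S \<subseteq> chain.span B"
      "card B = chain.dim (?c ` S)"
    using chain.basis_exists by blast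
  have "finite B" using B(1) assms(1) by (meson finite_imageI finite_subset)
  have notin: "?c \<sigma> \<notin> chain.span B" using chain.span_mono[OF B(1)] assms(2) by blast
  then have "?c \<sigma> \<notin> B" using chain.span_base by blast
  have "chain.dim (insert (?c \<sigma>) (?c ` S)) = card (insert (?c \<sigma>) B)"
  proof (rule chain.dim_unique)
    show "insert (?c \<sigma>) B \<subseteq> insert (?c \<sigma>) (?c ` S)" using B(1) by blast
    show "insert (?c \<sigma>) (?c ` S) \<subseteq> chain.span (insert (?c \<sigma>) B)"
      using B(3) chain.span_mono[of B "insert (?c \<sigma>) B"] chain.span_base by blast
    show "chain.independent (insert (?c \<sigma>) B)"
      using notin B(2) by (simp add: chain.independent_insert)
  qed simp
  then show ?thesis
    using \<open>finite B\<close> \<open>?c \<sigma> \<notin> B\<close> B(4) by (simp add: simplex_rank_def)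
qed

text \<open>Exactly one vertex of \<open>\<sigma>\<close> is missing from \<open>\<tau>\<close>, so
  the sum reduces to a single sign, which is nonzero in every characteristic.\<close>

lemma boundary_column_facet:
  assumes "finite \<sigma>" "card \<sigma> = d + 1" "\<tau> \<subseteq> \<sigma>" "card \<tau> = d"
  shows "(boundary_column \<sigma> \<tau> :: 'f::field) \<noteq> 0"
proof -
  have "card (\<sigma> - \<tau>) = 1" using assms by (simp add: card_Diff_subset finite_subset)
  then obtain v where "\<sigma> - \<tau> = {v}" by (rule card_1_singletonE)
  then have v: "v \<in> \<sigma>" "\<tau> = \<sigma> - {v}" using assms(3) by auto
  then have "\<tau> = \<sigma> - {w} \<longleftrightarrow> w = v" if "w \<in> \<sigma>" for w using that by blast
  then have "boundary_column \<sigma> \<tau> = (\<Sum>w\<in>\<sigma>. if w = v then (- 1 :: 'f) ^ card {u \<in> \<sigma>. u < w} else 0)"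
    unfolding boundary_column_def by (intro sum.cong) auto
  then show ?thesis using assms(1) v(1) by simp
qed

lemma boundary_column_not_subset: "\<not> \<tau> \<subseteq> \<sigma> \<Longrightarrow> boundary_column \<sigma> \<tau> = 0"
  unfolding boundary_column_def by (intro sum.neutral) auto

text \<open>The coordinate at the exposed facet separates: it vanishes on the columns of all
  remaining faces but not on the column of the removed face, which is therefore outside their
  span.\<close>

lemma simplex_rank_collapse:
  fixes K :: "'v::linorder set set"
  assumes "elementary_collapse d K K'" "finite (faces d K)"
    and "simplex_rank TYPE('f::field) (faces d K') = card (faces d K')"
  shows "simplex_rank TYPE('f) (faces d K) = card (faces d K)"
proof -
  obtain \<tau> \<sigma> where \<tau>: "card \<tau> = d" "\<tau> \<subseteq> \<sigma>" and \<sigma>: "\<sigma> \<in> faces d K"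
    and uniq: "\<And>\<rho>. \<rho> \<in> faces d K \<Longrightarrow> \<tau> \<subseteq> \<rho> \<Longrightarrow> \<rho> = \<sigma>" and K': "K' = K - {\<tau>, \<sigma>}"
    using assms(1) unfolding elementary_collapse_def exposed_def by blast
  have faces': "faces d K' = faces d K - {\<sigma>}" using \<tau>(1) by (simp add: K' faces_Diff_facet)
  have "chain.subspace {x :: 'v set \<Rightarrow> 'f. x \<tau> = 0}"
    by (auto simp: chain.subspace_def chain_scale_def)
  moreover have "(boundary_column :: 'v set \<Rightarrow> 'v set \<Rightarrow> 'f) ` faces d K' \<subseteq> {x. x \<tau> = 0}"
  proof (rule image_subsetI)
    fix \<rho> assume "\<rho> \<in> faces d K'"
    then have "\<not> \<tau> \<subseteq> \<rho>" using uniq[of \<rho>] faces' by blast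
    then show "(boundary_column \<rho> :: 'v set \<Rightarrow> 'f) \<in> {x. x \<tau> = 0}"
      by (simp add: boundary_column_not_subset)
  qed
  ultimately have span: "chain.span ((boundary_column :: 'v set \<Rightarrow> 'v set \<Rightarrow> 'f) ` faces d K') \<subseteq> {x. x \<tau> = 0}"
    by (rule chain.span_minimal[rotated])
  have "(boundary_column \<sigma> \<tau> :: 'f) \<noteq> 0"
    using faces_finite_card[OF \<sigma>] \<tau> by (intro boundary_column_facet[of _ d]) simp_all
  then have notin: "(boundary_column \<sigma> :: 'v set \<Rightarrow> 'f) \<notin> chain.span (boundary_column ` faces d K')"
    using span by (metis (mono_tags) mem_Collect_eq subsetD)
  have fin': "finite (faces d K')" using assms(2) faces' by simp
  have "\<sigma> \<notin> faces d K'" using faces' by simp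
  moreover have "faces d K = insert \<sigma> (faces d K')" using \<sigma> faces' by blast
  ultimately show ?thesis
    using simplex_rank_insert[OF fin' notin] assms(3) fin' by (metis card_insert_disjoint)
qed

text \<open>Read backwards, a collapsing sequence starts at rank 0 and adds faces one at a time,
  each raising the rank by one.\<close>

lemma simplex_rank_collapsible:
  fixes K :: "'v::linorder set set"
  assumes "collapsible d K" "finite (faces d K)"
  shows "simplex_rank TYPE('f::field) (faces d K) = card (faces d K)"
proof -
  obtain K' where "(elementary_collapse d)\<^sup>*\<^sup>* K K'" "faces d K' = {}"
    using assms(1) by (auto simp: collapsible_def)
  then show ?thesis using assms(2)
  proof (induction rule: converse_rtranclp_induct)
    case base
    then show ?case
      using chain.dim_eq_card_independent[OF chain.independent_empty, where 'a = 'f]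
      by (simp add: simplex_rank_def)
  next
    case (step K L)
    have "faces d L \<subseteq> faces d K"
      using step.hyps(1) unfolding elementary_collapse_def faces_def by blast
    then have "finite (faces d L)" using step.prems(2) finite_subset by blast
    with step.IH step.prems(1) have "simplex_rank TYPE('f) (faces d L) = card (faces d L)" by blast
    then show ?case by (rule simplex_rank_collapse[OF step.hyps(1) step.prems(2)])
  qed
qed

section \<open>Boundaries of triangles and the maximal rank\<close>

lemma boundary_column_triangle:
  fixes x y z :: "'v::linorder"
  assumes "x < y" "y < z"
  shows "(boundary_column {x, y, z} \<tau> :: 'f::field) =
    of_bool (\<tau> = {y, z}) - of_bool (\<tau> = {x, z}) + of_bool (\<tau> = {x, y})"
proof -
  define g where
    "g v = (if \<tau> = {x, y, z} - {v} then (- 1 :: 'f) ^ card {w \<in> {x, y, z}. w < v} else 0)" for v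
  have "{x, y, z} - {x} = {y, z}" and "{w \<in> {x, y, z}. w < x} = {}" using assms by auto
  then have gx: "g x = of_bool (\<tau> = {y, z})" unfolding g_def by (simp only: card.empty) simp
  have "{x, y, z} - {y} = {x, z}" and "{w \<in> {x, y, z}. w < y} = {x}" using assms by auto
  then have gy: "g y = - of_bool (\<tau> = {x, z})" unfolding g_def by (simp only:) simp
  have "{x, y, z} - {z} = {x, y}" and "{w \<in> {x, y, z}. w < z} = {x, y}" using assms by auto
  moreover have "card {x, y} = 2" using assms(1) by simp
  ultimately have gz: "g z = of_bool (\<tau> = {x, y})" unfolding g_def by (simp only:) simp
  have "boundary_column {x, y, z} \<tau> = sum g {x, y, z}"
    unfolding boundary_column_def by (intro sum.cong refl) (simp only: g_def)
  also have "\<dots> = g x + (g y + g z)"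
  proof -
    have "x \<noteq> y" "x \<noteq> z" "y \<noteq> z" using assms by auto
    then show ?thesis by simp
  qed
  finally show ?thesis by (simp add: gx gy gz)
qed

lemma simplices_2_sorted:
  fixes V :: "'v::linorder set"
  assumes "\<sigma> \<in> simplices 2 V"
  obtains x y z where "\<sigma> = {x, y, z}" "x < y" "y < z" "x \<in> V" "y \<in> V" "z \<in> V"
proof -
  have \<sigma>: "finite \<sigma>" "card \<sigma> = 3" "\<sigma> \<subseteq> V" using assms by (auto simp: simplices_def faces_def)
  define xs where "xs = sorted_list_of_set \<sigma>"
  have xs: "length xs = 3" "set xs = \<sigma>" "sorted_wrt (<) xs"
    using \<sigma> by (auto simp: xs_def)
  then obtain x y z where "xs = [x, y, z]"
    by (auto simp: numeral_3_eq_3 length_Suc_conv)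
  then show ?thesis using xs \<sigma>(3) that[of x y z] by auto
qed

text \<open>Coning with the least vertex: the boundary of a tetrahedron has boundary zero.\<close>

lemma simplex_rank_le_choose:
  fixes V :: "'v::linorder set"
  assumes "finite V" "v \<in> V" "\<And>w. w \<in> V \<Longrightarrow> v \<le> w" "S \<subseteq> simplices 2 V"
  shows "simplex_rank TYPE('f::field) S \<le> (card V - 1) choose 2"
proof -
  let ?c = "boundary_column :: 'v set \<Rightarrow> 'v set \<Rightarrow> 'f"
  \<comment> \<open>The sets \<open>insert v \<tau>\<close> with \<open>\<tau> \<in> E\<close> are
    the cones over the edges missing \<open>v\<close>; their columns will span all others.\<close>
  define E where "E = {\<tau>. \<tau> \<subseteq> V - {v} \<and> card \<tau> = 2}"
  define W where "W = ?c ` insert v ` E"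
  have E: "finite E" "card E = (card V - 1) choose 2"
    using assms(1,2) n_subsets[of "V - {v}" 2] by (auto simp: E_def)
  have W: "?c {v, x, y} \<in> chain.span W" if "x < y" "x \<in> V - {v}" "y \<in> V - {v}" for x y
  proof -
    have "{x, y} \<in> E" using that by (auto simp: E_def)
    then show ?thesis unfolding W_def by (intro chain.span_base) blast
  qed
  have "?c \<sigma> \<in> chain.span W" if "\<sigma> \<in> S" for \<sigma>
  proof -
    have "\<sigma> \<in> simplices 2 V" using that assms(4) by blast
    then obtain x y z where \<sigma>: "\<sigma> = {x, y, z}" "x < y" "y < z"
      and V: "x \<in> V" "y \<in> V" "z \<in> V"
      by (rule simplices_2_sorted)
    show ?thesis
    proof (cases "x = v")
      case True
      then show ?thesis using W[of y z] \<sigma> V by auto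
    next
      case False
      \<comment> \<open>Minimality of \<open>v\<close> gives \<open>v < x < y < z\<close>, so the
        sorted formula for triangles applies to all four faces of the tetrahedron.\<close>
      then have "v < x" using assms(3)[OF V(1)] by simp
      then have "?c \<sigma> = ?c {v, y, z} - ?c {v, x, z} + ?c {v, x, y}"
        using \<sigma> by (simp add: fun_eq_iff boundary_column_triangle)
      moreover have "?c {v, y, z} \<in> chain.span W" "?c {v, x, z} \<in> chain.span W"
          "?c {v, x, y} \<in> chain.span W"
        using \<open>v < x\<close> \<sigma> V by (auto intro!: W)
      ultimately show ?thesis
        using chain.span_add chain.span_diff by metis
    qed
  qed
  then have "chain.dim (?c ` S) \<le> card W"
    using E(1) by (intro chain.dim_le_card) (auto simp: W_def)
  also have "\<dots> \<le> card E"
    unfolding W_def using E(1) by (metis card_image_le finite_imageI le_trans)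
  finally show ?thesis using E(2) by (simp add: simplex_rank_def)
qed

section \<open>Perfect hypercuts\<close>

lemma perfect_hypercut_Diff:
  fixes V :: "'v::linorder set" and F :: "'f::field itself"
  assumes V: "finite V" and S: "almost_hypertree F V 2 S" and shadow: "shadow F V 2 S = {}"
    and ne: "S \<noteq> simplices 2 V"
  shows "perfect_hypercut F V (simplices 2 V - S)"
proof -
  have sub: "S \<subseteq> simplices 2 V" and rank: "simplex_rank F S = card S"
    and card: "card S + 1 = (card V - 1) choose 2" and acyc: "acyclic_set F V 2 S"
    using S by (auto simp: almost_hypertree_def acyclic_set_def)
  have fin: "finite (simplices 2 V)" and card_simplices: "card (simplices 2 V) = card V choose 3"
  proof -
    have "simplices 2 V = {\<sigma>. \<sigma> \<subseteq> V \<and> card \<sigma> = 3}"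
      using V by (auto simp: simplices_def faces_def intro: finite_subset)
    then show "finite (simplices 2 V)" "card (simplices 2 V) = card V choose 3"
      using V n_subsets[OF V, of 3] by auto
  qed
  have "finite S" using fin sub finite_subset by blast
  have bound: "card T \<le> card S + 1" if "acyclic_set F V 2 T" for T
  proof (cases "V = {}")
    \<comment> \<open>Without vertices there is no cone point, but then
      \<open>(card V - 1) choose 2\<close> is 0, contradicting \<open>card\<close>.\<close>
    case True
    then show ?thesis using card by (simp add: numeral_2_eq_2)
  next
    case False
    then show ?thesis
      using that simplex_rank_le_choose[of V "Min V" T, where 'f = 'f] V card
      by (simp add: acyclic_set_def simplex_rank_def)
  qed
  have tree: "hypertree F V 2 (insert \<sigma> S)" if \<sigma>: "\<sigma> \<in> simplices 2 V - S" for \<sigma>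
  proof -
    have neq: "simplex_rank F (insert \<sigma> S) \<noteq> simplex_rank F S"
      using shadow \<sigma> by (auto simp: shadow_def)
    have "(boundary_column \<sigma> :: 'v set \<Rightarrow> 'f) \<notin> chain.span (boundary_column ` S)"
    proof
      assume "(boundary_column \<sigma> :: 'v set \<Rightarrow> 'f) \<in> chain.span (boundary_column ` S)"
      from arg_cong[OF chain.span_redundant[OF this], of chain.dim]
      show False using neq by (simp add: simplex_rank_def)
    qed
    from simplex_rank_insert[OF \<open>finite S\<close> this]
    have "simplex_rank F (insert \<sigma> S) = Suc (simplex_rank F S)"
      by (simp add: simplex_rank_def)
    then have acyc': "acyclic_set F V 2 (insert \<sigma> S)"
      using \<sigma> sub rank \<open>finite S\<close> by (auto simp: acyclic_set_def)
    \<comment> \<open>\<open>insert \<sigma> S\<close> already has \<open>card S + 1\<close>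
      elements, the bound for every acyclic set, so nothing acyclic contains it properly.\<close>
    moreover have "T = insert \<sigma> S" if "acyclic_set F V 2 T" "insert \<sigma> S \<subseteq> T" for T
    proof -
      have "finite T" using that(1) fin finite_subset by (auto simp: acyclic_set_def)
      then show ?thesis
        using card_seteq[of T "insert \<sigma> S"] that bound[OF that(1)] \<sigma> \<open>finite S\<close> by auto
    qed
    ultimately show ?thesis unfolding hypertree_def by blast
  qed
  have "meets_hypertrees F V 2 (simplices 2 V - S)"
  proof -
    \<comment> \<open>A hypertree missing the complement lies in \<open>S\<close>, hence equals
      \<open>S\<close> by maximality, yet \<open>S\<close> can be enlarged to the hypertree
      \<open>insert \<sigma> S\<close>.\<close>
    have False if T: "hypertree F V 2 T" and "(simplices 2 V - S) \<inter> T = {}" for T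
    proof -
      have "T \<subseteq> S" using that by (auto simp: hypertree_def acyclic_set_def)
      then have "S = T" using T acyc by (auto simp: hypertree_def)
      obtain \<sigma> where \<sigma>: "\<sigma> \<in> simplices 2 V - S" using ne sub by blast
      then have "insert \<sigma> S = T"
        using tree T \<open>S = T\<close> unfolding hypertree_def by blast
      then show False using \<sigma> \<open>S = T\<close> by blast
    qed
    then show ?thesis by (auto simp: meets_hypertrees_def)
  qed
  moreover have "\<not> meets_hypertrees F V 2 D" if D: "D \<subset> simplices 2 V - S" for D
  proof -
    obtain \<sigma> where "\<sigma> \<in> simplices 2 V - S" "\<sigma> \<notin> D" using D by blast
    then have "hypertree F V 2 (insert \<sigma> S)" "D \<inter> insert \<sigma> S = {}" using tree D by auto
    then show ?thesis by (auto simp: meets_hypertrees_def)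
  qed
  moreover have "card (simplices 2 V - S) + card S = card V choose 3"
    using card_Diff_subset[OF \<open>finite S\<close> sub] card_mono[OF fin sub] card_simplices by simp
  ultimately show ?thesis
    using card by (auto simp: perfect_hypercut_def hypercut_def)
qed

section \<open>Residues as signed powers of two\<close>

text \<open>Signed powers of two contain both generators and are closed modulo \<open>p\<close>
  under products and inverses. Fermat's little theorem keeps the exponent positive
  throughout.\<close>

lemma (in residues_prime) generate_power_of_two:
  assumes "p > 2" and "x \<in> generate (units_of R) {\<ominus> \<one>, \<one> \<oplus> \<one>}"
  shows "\<exists>k>0. int p dvd x - 2 ^ k \<or> int p dvd x + 2 ^ k"
proof -
  \<comment> \<open>The sign is carried as a factor \<open>s\<close> with \<open>s * s = 1\<close>,
    so that products need no case distinction.\<close>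
  define P where "P x \<longleftrightarrow> (\<exists>k s. k > 0 \<and> (s = 1 \<or> s = - 1) \<and> int p dvd x - s * 2 ^ k)" for x
  have PI: "P x" if "k > 0" "s = 1 \<or> s = - 1" "int p dvd x - s * 2 ^ k" for x k s
    using that unfolding P_def by blast
  have PE: "\<exists>k s. k > 0 \<and> (s = 1 \<or> s = - 1) \<and> int p dvd x - s * 2 ^ k" if "P x" for x
    using that unfolding P_def .
  have odd: "\<not> p dvd 2" using assms(1) by (auto dest: dvd_imp_le)
  with p_prime have "[2 ^ (p - 1) = 1] (mod p)" by (rule fermat_theorem)
  then have "[int (2 ^ (p - 1)) = int 1] (mod int p)" by (simp only: cong_int_iff)
  then have fermat: "[2 ^ (p - 1) = 1] (mod int p)" by simp
  have P_mod: "P (a mod int p)" if "P a" for a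
  proof -
    from PE[OF that] obtain k s where ks: "k > 0" "s = 1 \<or> s = - 1" "int p dvd a - s * 2 ^ k"
      by blast
    have "int p dvd a mod int p - a" by (simp add: mod_eq_dvd_iff[symmetric])
    then have "int p dvd (a mod int p - a) + (a - s * 2 ^ k)" using ks(3) by (rule dvd_add)
    then have "int p dvd a mod int p - s * 2 ^ k" by simp
    then show ?thesis by (rule PI[OF ks(1,2)])
  qed
  have P_mult: "P (a * b)" if "P a" "P b" for a b
  proof -
    from PE[OF that(1)] obtain i s where i: "i > 0" "s = 1 \<or> s = -1" "int p dvd a - s * 2 ^ i"
      by blast
    from PE[OF that(2)] obtain j t where j: "j > 0" "t = 1 \<or> t = -1" "int p dvd b - t * 2 ^ j"
      by blast
    have "int p dvd (a - s * 2 ^ i) * b + (s * 2 ^ i) * (b - t * 2 ^ j)"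
      using i(3) j(3) by (rule dvd_add[OF dvd_mult2 dvd_mult])
    also have "(a - s * 2 ^ i) * b + (s * 2 ^ i) * (b - t * 2 ^ j) = a * b - (s * t) * 2 ^ (i + j)"
      by (simp add: algebra_simps power_add)
    finally show ?thesis using i(1,2) j(2) by (intro PI[of "i + j" "s * t"]) auto
  qed
  have P_inverse: "P i" if "int p dvd i * h - 1" "P h" for i h
  proof -
    from PE[OF that(2)] obtain k s where k: "k > 0" "s = 1 \<or> s = -1" "int p dvd h - s * 2 ^ k"
      by blast
    \<comment> \<open>The inverse of \<open>s * 2 ^ k\<close> is \<open>s * 2 ^ m\<close>, because
      \<open>2 ^ (m + k)\<close> is a power of \<open>2 ^ (p - 1)\<close>.\<close>
    define m where "m = k * (p - 2)"
    have "m + k = k * (p - 2 + 1)" by (simp add: m_def)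
    also have "p - 2 + 1 = p - 1" using assms(1) by simp
    finally have mk: "2 ^ (m + k) = ((2::int) ^ (p - 1)) ^ k"
      by (metis power_mult mult.commute)
    have "[(2 ^ (p - 1)) ^ k = 1 ^ k] (mod int p)" using fermat by (rule cong_pow)
    then have "int p dvd 2 ^ (m + k) - 1" unfolding mk by (simp add: cong_iff_dvd_diff)
    then have 1: "int p dvd (- i) * (2 ^ (m + k) - 1)" by (rule dvd_mult)
    have 2: "int p dvd (- s * i * 2 ^ m) * (h - s * 2 ^ k)" using k(3) by (rule dvd_mult)
    have 3: "int p dvd (s * 2 ^ m) * (i * h - 1)" using that(1) by (rule dvd_mult)
    \<comment> \<open>The three multiples of \<open>p\<close> are weighted so that all terms cancel
      except \<open>i - s * 2 ^ m\<close> and a multiple of \<open>s * s - 1\<close>.\<close>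
    have "int p dvd (- i) * (2 ^ (m + k) - 1) + (- s * i * 2 ^ m) * (h - s * 2 ^ k)
        + (s * 2 ^ m) * (i * h - 1)"
      by (intro dvd_add 1 2 3)
    also have "(- i) * (2 ^ (m + k) - 1) + (- s * i * 2 ^ m) * (h - s * 2 ^ k)
        + (s * 2 ^ m) * (i * h - 1) = i - s * 2 ^ m + i * 2 ^ (m + k) * (s * s - 1)"
      by (simp add: algebra_simps power_add)
    also have "s * s - 1 = 0" using k(2) by auto
    finally have "int p dvd i - s * 2 ^ m" by simp
    moreover have "m > 0" using k(1) assms(1) by (simp add: m_def)
    ultimately show ?thesis using PI k(2) by blast
  qed
  \<comment> \<open>The exponent 0 is excluded, so 1 and -1 are represented with exponent
    \<open>p - 1\<close> instead.\<close>
  have "int p dvd 2 ^ (p - 1) - 1" using fermat by (simp only: cong_iff_dvd_diff)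
  moreover from this have "int p dvd - (2 ^ (p - 1) - 1)" by (simp only: dvd_minus_iff)
  ultimately have P_1: "P 1" and P_minus_1: "P (- 1)"
    using PI[of "p - 1" 1 1] PI[of "p - 1" "- 1" "- 1"] assms(1) by simp_all
  have P_2: "P 2" by (intro PI[of 1 1]) simp_all
  have gen: "h = (- 1) mod int p \<or> h = 2 mod int p" if "h \<in> {\<ominus> \<one>, \<one> \<oplus> \<one>}" for h
    using that by (auto simp: res_neg_eq res_add_eq res_one_eq)
  have P_gen: "P h" if "h \<in> {\<ominus> \<one>, \<one> \<oplus> \<one>}" for h
    using gen[OF that] P_mod[OF P_minus_1] P_mod[OF P_2] by blast
  have "\<not> int p dvd 2" using odd by presburger
  then have coprime: "coprime (- 1) (int p)" "coprime 2 (int p)"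
    using p_coprime_right_int[of 2] by simp_all
  interpret U: group "units_of R" by (rule units_group)
  from assms(2) have "P x"
  proof (induction rule: generate.induct)
    case one
    then show ?case using P_1 by (simp only: units_of_one res_one_eq)
  next
    case (incl h)
    then show ?case by (rule P_gen)
  next
    case (inv h)
    have "h \<in> Units R"
      using gen[OF inv] mod_in_res_units[OF m_gt_one coprime(1)]
        mod_in_res_units[OF m_gt_one coprime(2)] by blast
    then have "inv\<^bsub>units_of R\<^esub> h \<otimes>\<^bsub>units_of R\<^esub> h = \<one>\<^bsub>units_of R\<^esub>"
      by (intro U.l_inv) (simp only: units_of_carrier)
    then have "(inv\<^bsub>units_of R\<^esub> h * h) mod int p = 1 mod int p"
      using m_gt_one by (simp add: units_of_mult units_of_one res_mult_eq res_one_eq)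
    then have "int p dvd inv\<^bsub>units_of R\<^esub> h * h - 1" by (simp only: mod_eq_dvd_iff)
    then show ?case using P_gen[OF inv] by (rule P_inverse)
  next
    case (eng a b)
    then show ?case using P_mod[OF P_mult] by (simp only: units_of_mult res_mult_eq)
  qed
  from PE[OF this] show ?thesis by auto
qed

text \<open>If the smallest power occurred in one summand only, the other two would be divisible by
  twice that power, and the sum could not vanish.\<close>

lemma zero_sum_of_powers_of_two:
  fixes A B C :: int
  assumes "\<bar>A\<bar> = 2 ^ i" "\<bar>B\<bar> = 2 ^ j" "\<bar>C\<bar> = 2 ^ k" "A + B + C = 0"
  shows "A = B \<or> B = C \<or> A = C"
proof -
  have *: "A = B \<or> A = C"
    if "\<bar>A\<bar> = 2 ^ i" "\<bar>B\<bar> = 2 ^ j" "\<bar>C\<bar> = 2 ^ k" "A + B + C = 0" "i \<le> j" "i \<le> k"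
    for A B C :: int and i j k :: nat
  proof (rule ccontr)
    assume "\<not> (A = B \<or> A = C)"
    then have ne: "A \<noteq> B" "A \<noteq> C" by auto
    have "A \<noteq> 0" "B \<noteq> 0" "C \<noteq> 0" using that(1-3) by auto
    \<comment> \<open>Equal absolute values with \<open>A \<noteq> B\<close> would mean
      \<open>A = - B\<close>, leaving 0 for the third summand.\<close>
    then have "\<bar>A\<bar> \<noteq> \<bar>B\<bar>" "\<bar>A\<bar> \<noteq> \<bar>C\<bar>" using ne that(4) by linarith+
    then have "i \<noteq> j" "i \<noteq> k" using that(1-3) by auto
    then have "Suc i \<le> j" "Suc i \<le> k" using that(5,6) by auto
    then have "(2::int) ^ Suc i dvd \<bar>B\<bar>" "(2::int) ^ Suc i dvd \<bar>C\<bar>"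
      unfolding that(2,3) by (simp_all only: le_imp_power_dvd)
    then have "(2::int) ^ Suc i dvd B + C" by simp
    moreover have "A = - (B + C)" using that(4) by simp
    ultimately have "(2::int) ^ Suc i dvd \<bar>A\<bar>" by (simp only: dvd_minus_iff dvd_abs_iff)
    then have "(2::int) ^ Suc i \<le> 2 ^ i" unfolding that(1) by (rule zdvd_imp_le) simp
    then show False by simp
  qed
  consider "i \<le> j" "i \<le> k" | "j \<le> i" "j \<le> k" | "k \<le> i" "k \<le> j" by linarith
  then show ?thesis
  proof cases
    case 1
    then show ?thesis using *[OF assms] by blast
  next
    case 2
    then show ?thesis using *[of B j A i C k] assms by (auto simp: add_ac)
  next
    case 3
    then show ?thesis using *[of C k A i B j] assms by (auto simp: add_ac)
  qed
qed

section \<open>Levels and integer lifts of residues\<close>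

text \<open>The hypothesis on generators enters only as \<open>power_of_two\<close>, so the rest is
  plain divisibility of integers by a prime for which 2 and 3 are invertible.\<close>

locale two_generates =
  fixes n :: nat
  assumes n_ge_5: "n \<ge> 5" and prime_n: "prime n"
    and power_of_two: "\<not> int n dvd d \<Longrightarrow> \<exists>k>0. int n dvd d - 2 ^ k \<or> int n dvd d + 2 ^ k"
begin

abbreviation N :: int where "N \<equiv> int n"

lemma prime_N: "prime N"
  using prime_n by simp

lemma dvd_2_times: "N dvd 2 * x \<longleftrightarrow> N dvd x"
proof -
  have "\<not> N dvd 2" using n_ge_5 by (auto dest: zdvd_imp_le)
  then show ?thesis using prime_N by (simp add: prime_dvd_mult_iff)
qed

lemma dvd_3_times: "N dvd 3 * x \<longleftrightarrow> N dvd x"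
proof -
  have "\<not> N dvd 3" using n_ge_5 by (auto dest: zdvd_imp_le)
  then show ?thesis using prime_N by (simp add: prime_dvd_mult_iff)
qed

lemma dvd_diff_iff_eq:
  assumes "x \<in> {0..<N}" "y \<in> {0..<N}"
  shows "N dvd x - y \<longleftrightarrow> x = y"
proof
  assume "N dvd x - y"
  then have "x mod N = y mod N" by (simp add: mod_eq_dvd_iff)
  then show "x = y" using assms by simp
qed simp

text \<open>Demanding \<open>k > 0\<close> puts 2 at the start of the chain of doublings and 1 at
  its end. Multiples of \<open>N\<close> admit no \<open>k\<close>, and their level is an
  unspecified constant.\<close>

definition level :: "int \<Rightarrow> nat" where
  "level d = (LEAST k. k > 0 \<and> (N dvd d - 2 ^ k \<or> N dvd d + 2 ^ k))"

definition lift :: "int \<Rightarrow> int" where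
  "lift d = (if N dvd d - 2 ^ level d then 2 ^ level d else - (2 ^ level d))"

lemma level:
  assumes "\<not> N dvd d"
  shows "level d > 0" "N dvd d - 2 ^ level d \<or> N dvd d + 2 ^ level d"
  using LeastI_ex[OF power_of_two[OF assms]] by (simp_all add: level_def)

lemma level_le: "k > 0 \<Longrightarrow> N dvd d - 2 ^ k \<or> N dvd d + 2 ^ k \<Longrightarrow> level d \<le> k"
  unfolding level_def by (rule Least_le) simp

lemma dvd_add_cong:
  assumes "N dvd a - b"
  shows "N dvd a + c \<longleftrightarrow> N dvd b + c"
proof -
  have "a + c = (b + c) + (a - b)" by simp
  then show ?thesis using assms dvd_add_left_iff by metis
qed

lemma level_cong:
  assumes "N dvd a - b"
  shows "level a = level b"
  unfolding level_def using dvd_add_cong[OF assms] by (simp only: diff_conv_add_uminus)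

lemma level_minus: "level (- d) = level d"
proof -
  have "N dvd - d - 2 ^ k \<longleftrightarrow> N dvd d + 2 ^ k" for k
    using dvd_minus_iff[of N "d + 2 ^ k"] by simp
  moreover have "N dvd - d + 2 ^ k \<longleftrightarrow> N dvd d - 2 ^ k" for k
    using dvd_minus_iff[of N "d - 2 ^ k"] by simp
  ultimately show ?thesis unfolding level_def by (simp only: disj_commute)
qed

text \<open>Both inequalities come from cancelling the factor 2 modulo \<open>N\<close>.\<close>

lemma level_double:
  assumes "\<not> N dvd d" "\<not> N dvd d - 1" "\<not> N dvd d + 1"
  shows "level (2 * d) = Suc (level d)"
proof (rule antisym)
  have "N dvd 2 * (d - 2 ^ level d) \<or> N dvd 2 * (d + 2 ^ level d)"
    using level(2)[OF assms(1)] by (simp only: dvd_2_times)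
  then show "level (2 * d) \<le> Suc (level d)"
    by (intro level_le) (simp_all only: right_diff_distrib distrib_left power_Suc zero_less_Suc)
  have "\<not> N dvd 2 * d" using assms(1) by (simp add: dvd_2_times)
  note * = level[OF this]
  then obtain j where j: "level (2 * d) = Suc j" using gr0_implies_Suc by blast
  have "N dvd 2 * (d - 2 ^ j) \<or> N dvd 2 * (d + 2 ^ j)"
    using *(2) unfolding j by (simp only: right_diff_distrib distrib_left power_Suc)
  then have d: "N dvd d - 2 ^ j \<or> N dvd d + 2 ^ j" by (simp only: dvd_2_times)
  \<comment> \<open>\<open>j = 0\<close> would say that \<open>d\<close> is 1 or -1 modulo
    \<open>N\<close>.\<close>
  then have "j > 0" using assms(2,3) by (cases j) auto
  then show "Suc (level d) \<le> level (2 * d)" using level_le[OF _ d] j by simp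
qed

lemma level_2: "level 2 = 1"
proof -
  have "level 2 \<le> 1" by (rule level_le) simp_all
  moreover have "\<not> N dvd 2" using dvd_2_times[of 1] n_ge_5 by simp
  then have "level 2 > 0" by (rule level(1))
  ultimately show ?thesis by simp
qed

lemma dvd_lift_diff: "\<not> N dvd d \<Longrightarrow> N dvd d - lift d"
  using level(2)[of d] by (auto simp: lift_def)

lemma abs_lift: "\<bar>lift d\<bar> = 2 ^ level d"
  by (simp add: lift_def)

text \<open>The absolute value fixes \<open>lift d\<close> up to sign, and the wrong sign would make
  \<open>N\<close> divide \<open>2 * d\<close>.\<close>

lemma lift_eqI:
  assumes "\<bar>c\<bar> = 2 ^ level d" "N dvd d - c" "\<not> N dvd d"
  shows "lift d = c"
proof (rule ccontr)
  assume "lift d \<noteq> c"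
  then have "lift d = - c" using assms(1) abs_lift[of d] by linarith
  then have "N dvd d + c" using dvd_lift_diff[OF assms(3)] by simp
  then have "N dvd (d + c) + (d - c)" using assms(2) by (rule dvd_add)
  then show False using assms(3) dvd_2_times[of d] by simp
qed

lemma lift_cong:
  assumes "N dvd a - b" "\<not> N dvd a"
  shows "lift a = lift b"
proof (rule lift_eqI)
  show "\<bar>lift b\<bar> = 2 ^ level a" by (simp add: abs_lift level_cong[OF assms(1)])
  have "\<not> N dvd b" using assms dvd_add_cong[of a b 0] by simp
  then have "N dvd (a - b) + (b - lift b)" using assms(1) dvd_lift_diff by (intro dvd_add)
  then show "N dvd a - lift b" by simp
qed fact

lemma lift_minus:
  assumes "\<not> N dvd d"
  shows "lift (- d) = - lift d"
proof (rule lift_eqI)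
  have "- d - - lift d = - (d - lift d)" by simp
  then show "N dvd - d - - lift d" using dvd_lift_diff[OF assms] dvd_minus_iff by metis
qed (use assms in \<open>simp_all add: abs_lift level_minus\<close>)

lemma lift_double:
  assumes "\<not> N dvd d" "\<not> N dvd d - 1" "\<not> N dvd d + 1"
  shows "lift (2 * d) = 2 * lift d"
proof (rule lift_eqI)
  show "\<bar>2 * lift d\<bar> = 2 ^ level (2 * d)" by (simp add: abs_mult abs_lift level_double[OF assms])
  have "2 * d - 2 * lift d = 2 * (d - lift d)" by simp
  then show "N dvd 2 * d - 2 * lift d" using dvd_lift_diff[OF assms(1)] dvd_mult by metis
  show "\<not> N dvd 2 * d" using assms(1) by (simp add: dvd_2_times)
qed

text \<open>Equal lifts give congruent residues. Moreover \<open>lift c = - 2 * lift a\<close>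
  forces \<open>level c\<close> to be at least 2, whereas \<open>a\<close> congruent to 1 or -1
  would make \<open>c\<close> congruent to -2 or 2, of level 1.\<close>

lemma lift_eq_sum:
  assumes "\<not> N dvd a" "\<not> N dvd b" "\<not> N dvd c"
    and "lift a = lift b" "lift a + lift b + lift c = 0"
  shows "N dvd a - b \<and> \<not> N dvd a - 1 \<and> \<not> N dvd a + 1"
proof -
  have a: "N dvd a - lift a" and b: "N dvd b - lift a" and c: "N dvd c - lift c"
    using assms dvd_lift_diff[of a] dvd_lift_diff[of b] dvd_lift_diff[of c] by simp_all
  have "N dvd a - b" using dvd_diff[OF a b] by simp
  have lc: "lift c = - 2 * lift a" using assms(4,5) by simp
  then have "\<bar>lift c\<bar> = 2 ^ Suc (level a)" by (simp add: abs_mult abs_lift)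
  then have "(2::int) ^ level c = 2 ^ Suc (level a)" by (simp only: abs_lift)
  then have "level c = Suc (level a)" by (rule power_inject_exp[THEN iffD1, rotated]) simp
  then have "level c \<noteq> 1" using level(1)[OF assms(1)] by simp
  have "(c - lift c) + 2 * (a - lift a) = c + 2 * a + 0" using lc by simp
  then have *: "N dvd c + 2 * a" using a c by (metis add_0_right dvd_add dvd_mult)
  have "\<not> N dvd a - 1"
  proof
    assume "N dvd a - 1"
    then have "N dvd (c + 2 * a) - 2 * (a - 1)" by (rule dvd_diff[OF * dvd_mult])
    then have "N dvd c - (- 2)" by (simp add: algebra_simps)
    then show False using level_cong[of c "- 2"] level_minus[of 2] level_2 \<open>level c \<noteq> 1\<close> by simp
  qed
  moreover have "\<not> N dvd a + 1"
  proof
    assume "N dvd a + 1"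
    then have "N dvd (c + 2 * a) - 2 * (a + 1)" by (rule dvd_diff[OF * dvd_mult])
    then have "N dvd c - 2" by (simp add: algebra_simps)
    then show False using level_cong[of c 2] level_2 \<open>level c \<noteq> 1\<close> by simp
  qed
  ultimately show ?thesis using \<open>N dvd a - b\<close> by blast
qed

section \<open>Progressions as faces\<close>

text \<open>The order of the arguments records the middle term, which the set
  \<open>{x, y, z}\<close> forgets; divisibility replaces the ring operations.\<close>

definition progression :: "int \<Rightarrow> int \<Rightarrow> int \<Rightarrow> bool" where
  "progression x y z \<longleftrightarrow> {x, y, z} \<subseteq> {0..<N} \<and> N dvd x + z - 2 * y
     \<and> \<not> N dvd y - x \<and> \<not> N dvd y - x - 1 \<and> \<not> N dvd y - x + 1"

lemma carrier_Zmod: "carrier (Zmod n) = {0..<N}"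
  by (auto simp: Zmod_def residue_ring_def)

text \<open>The difference is recovered as the remainder of \<open>y - x\<close>, and shifting by it
  preserves divisibility, so the excluded differences match the three non-divisibilities.\<close>

lemma AP_faces_eq: "AP_faces n = {{x, y, z} | x y z. progression x y z}"
proof -
  interpret residues N "Zmod n"
    unfolding Zmod_def by unfold_locales (use n_ge_5 in auto)
  have explicit: "AP_faces n = {{a, (a + d) mod N, ((a + d) mod N + d) mod N} | a d.
      a \<in> {0..<N} \<and> d \<in> {0..<N} - {0, 1, (- 1) mod N}}"
    unfolding AP_faces_def
    by (simp only: res_neg_eq res_add_eq res_zero_eq res_one_eq carrier_Zmod)
  have N5: "N \<ge> 5" using n_ge_5 by simp
  show ?thesis
  proof (intro equalityI subsetI)
    fix \<sigma> assume "\<sigma> \<in> AP_faces n"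
    then obtain a d where a: "a \<in> {0..<N}" and d: "d \<in> {0..<N}" "d \<noteq> 0" "d \<noteq> 1" "d \<noteq> (- 1) mod N"
      and \<sigma>: "\<sigma> = {a, (a + d) mod N, ((a + d) mod N + d) mod N}"
      unfolding explicit by blast
    define y where "y = (a + d) mod N"
    define z where "z = (y + d) mod N"
    have y: "y - a - d = - N * ((a + d) div N)"
      using minus_mult_div_eq_mod[of "a + d" N] by (simp add: y_def algebra_simps)
    have z: "z - y - d = - N * ((y + d) div N)"
      using minus_mult_div_eq_mod[of "y + d" N] by (simp add: z_def algebra_simps)
    have dy: "N dvd y - a - d" unfolding y by simp
    have dz: "N dvd z - y - d" unfolding z by simp
    have shift: "N dvd (y - a) + c \<longleftrightarrow> N dvd d + c" for c
      using dy by (rule dvd_add_cong)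
    have m1: "(- 1) mod N = N - 1" using N5 by (simp add: zmod_minus1)
    have "progression a y z"
      unfolding progression_def
    proof (intro conjI)
      show "{a, y, z} \<subseteq> {0..<N}" using a N5 by (auto simp: y_def z_def)
      have "N dvd (z - y - d) - (y - a - d)" using dz dy by (rule dvd_diff)
      then show "N dvd a + z - 2 * y" by (simp add: algebra_simps)
      show "\<not> N dvd y - a" using shift[of 0] d dvd_diff_iff_eq[of d 0] N5 by auto
      show "\<not> N dvd y - a - 1" using shift[of "- 1"] d dvd_diff_iff_eq[of d 1] N5 by auto
      have "N dvd d + 1 \<longleftrightarrow> N dvd d - (N - 1)"
        using dvd_add_times_triv_right_iff[of N "d - (N - 1)" 1] by (simp add: algebra_simps)
      then show "\<not> N dvd y - a + 1"
        using shift[of 1] d m1 dvd_diff_iff_eq[of d "N - 1"] N5 by auto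
    qed
    then show "\<sigma> \<in> {{x, y, z} | x y z. progression x y z}" using \<sigma> y_def z_def by blast
  next
    fix \<sigma> assume "\<sigma> \<in> {{x, y, z} | x y z. progression x y z}"
    then obtain x y z where \<sigma>: "\<sigma> = {x, y, z}" and p: "progression x y z" by blast
    define d where "d = (y - x) mod N"
    have xyz: "x \<in> {0..<N}" "y \<in> {0..<N}" "z \<in> {0..<N}" using p by (auto simp: progression_def)
    have "d = y - x - N * ((y - x) div N)"
      by (simp add: d_def minus_mult_div_eq_mod)
    then have dd: "N dvd (y - x) - d" by simp
    have shift: "N dvd (y - x) + c \<longleftrightarrow> N dvd d + c" for c
      using dd by (rule dvd_add_cong)
    have y: "(x + d) mod N = y"
    proof -
      have "N dvd (x + d) - y" using dd by (metis dvd_minus_iff minus_diff_eq add.commute diff_diff_eq2)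
      then have "(x + d) mod N = y mod N" by (simp add: mod_eq_dvd_iff)
      then show ?thesis using xyz(2) by simp
    qed
    have z: "(y + d) mod N = z"
    proof -
      have "N dvd x + z - 2 * y" using p by (simp add: progression_def)
      then have "N dvd ((y - x) - d) + (x + z - 2 * y)" using dd by (intro dvd_add)
      then have "N dvd - ((y + d) - z)" by (simp add: algebra_simps)
      then have "(y + d) mod N = z mod N" by (simp only: mod_eq_dvd_iff dvd_minus_iff)
      then show ?thesis using xyz(3) by simp
    qed
    have d: "d \<in> {0..<N}" using N5 by (simp add: d_def)
    have "d \<noteq> 0" using shift[of 0] p by (auto simp: progression_def)
    moreover have "d \<noteq> 1" using shift[of "- 1"] p by (auto simp: progression_def)
    moreover have "d \<noteq> (- 1) mod N"
      using shift[of 1] p N5 by (auto simp: progression_def zmod_minus1)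
    ultimately have "d \<in> {0..<N} - {0, 1, (- 1) mod N}" using d by blast
    moreover have "\<sigma> = {x, (x + d) mod N, ((x + d) mod N + d) mod N}" by (simp only: \<sigma> y z)
    ultimately show "\<sigma> \<in> AP_faces n" unfolding explicit using xyz(1) by blast
  qed
qed

text \<open>Reversal negates the difference, and the excluded set of differences is closed under
  negation.\<close>

lemma progression_sym: "progression x y z \<Longrightarrow> progression z y x"
proof -
  assume p: "progression x y z"
  then have "N dvd (y - x) - (z - y)"
    using dvd_minus_iff[of N "x + z - 2 * y"] by (simp add: progression_def algebra_simps)
  from dvd_add_cong[OF this] have *: "N dvd (y - x) + c \<longleftrightarrow> N dvd - ((y - z) + (- c))" for c
    by (simp add: algebra_simps)
  show "progression z y x"
    using p *[of 0] *[of 1] *[of "- 1"] unfolding dvd_minus_iff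
    by (simp add: progression_def algebra_simps)
qed

lemma progressionD:
  assumes "progression x y z"
  shows "x \<in> {0..<N}" "y \<in> {0..<N}" "z \<in> {0..<N}" "x \<noteq> y" "y \<noteq> z" "x \<noteq> z"
    "\<not> N dvd y - x" "N dvd (z - y) - (y - x)" "N dvd (z - x) - 2 * (y - x)"
proof -
  show "x \<in> {0..<N}" "y \<in> {0..<N}" "z \<in> {0..<N}" and nd: "\<not> N dvd y - x"
    using assms by (auto simp: progression_def)
  show "x \<noteq> y" "y \<noteq> z"
    using assms progression_sym[OF assms] by (auto simp: progression_def)
  show "N dvd (z - y) - (y - x)" and 1: "N dvd (z - x) - 2 * (y - x)"
    using assms by (auto simp: progression_def algebra_simps)
  show "x \<noteq> z"
  proof
    assume "x = z"
    then have "N dvd - (2 * (y - x))" using 1 by (simp only: diff_self diff_0)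
    then show False using nd by (simp only: dvd_minus_iff dvd_2_times)
  qed
qed

lemma card_progression: "progression x y z \<Longrightarrow> card {x, y, z} = 3"
  using progressionD[of x y z] by simp

lemma faces_AP_complex: "faces 2 (AP_complex n) = AP_faces n"
proof
  show "faces 2 (AP_complex n) \<subseteq> AP_faces n"
    by (auto simp: faces_def AP_complex_def)
  show "AP_faces n \<subseteq> faces 2 (AP_complex n)"
    using card_progression by (auto simp: faces_def AP_complex_def AP_faces_eq)
qed

lemma AP_faces_subset: "AP_faces n \<subseteq> simplices 2 {0..<N}"
  using card_progression by (auto simp: simplices_def faces_def AP_faces_eq progression_def)

lemma finite_AP_faces: "finite (AP_faces n)"
proof (rule finite_subset)
  show "AP_faces n \<subseteq> Pow {0..<N}" using AP_faces_subset by (auto simp: simplices_def faces_def)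
qed simp

text \<open>Two distinct middle terms \<open>a\<close> and \<open>y\<close> with common third vertex
  \<open>c\<close> satisfy both congruences \<open>y + c = 2 * a\<close> and
  \<open>a + c = 2 * y\<close>; subtracting gives \<open>3 * (y - a) = 0\<close>, and 3 is
  invertible.\<close>

lemma progression_middle_unique:
  assumes "progression x y z" "progression x' y' z'" "{x, y, z} = {x', y', z'}"
  shows "y = y'"
proof (rule ccontr)
  assume "y \<noteq> y'"
  have *: False if p: "progression a y c" and "progression x' a z'" "{x', z'} = {y, c}" for a c
  proof -
    have "x' + z' = y + c" using that(2,3) progressionD(6) by (fastforce simp: doubleton_eq_iff)
    then have "N dvd y + c - 2 * a" using that(2) by (simp add: progression_def)
    moreover have "N dvd a + c - 2 * y" using p by (simp add: progression_def)
    ultimately have "N dvd (y + c - 2 * a) - (a + c - 2 * y)" by (rule dvd_diff)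
    moreover have "(y + c - 2 * a) - (a + c - 2 * y) = 3 * (y - a)" by simp
    ultimately have "N dvd y - a" by (simp only: dvd_3_times)
    then show False using p by (simp add: progression_def)
  qed
  have diff: "{x, y, z} - {x} = {y, z}" "{x, y, z} - {z} = {y, x}" "{x', y', z'} - {y'} = {x', z'}"
    using progressionD(4-6)[OF assms(1)] progressionD(4-6)[OF assms(2)] by auto
  have "y' \<in> {x, y, z}" using assms(3) by auto
  then consider "y' = x" | "y' = z" using \<open>y \<noteq> y'\<close> by auto
  then show False
  proof cases
    case 1
    then have "{x', z'} = {y, z}" using assms(3) diff by metis
    then show False using *[of x z] assms(1,2) 1 by simp
  next
    case 2
    then have "{x', z'} = {y, x}" using assms(3) diff by metis
    then show False using *[of z x] progression_sym[OF assms(1)] assms(2) 2 by simp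
  qed
qed

text \<open>Summing over all pairs of vertices avoids a choice of order on the progression; the sum is
  increasing in the level of the difference.\<close>

definition face_level :: "int set \<Rightarrow> nat" where
  "face_level \<sigma> = (\<Sum>x\<in>\<sigma>. \<Sum>y\<in>\<sigma>. level (x - y))"

section \<open>Levels of faces and the collapse\<close>

lemma level_progression:
  assumes "progression x y z"
  shows "level (z - y) = level (y - x)" "level (z - x) = Suc (level (y - x))"
proof -
  show "level (z - y) = level (y - x)" using level_cong progressionD(8)[OF assms] .
  have "level (z - x) = level (2 * (y - x))" using level_cong progressionD(9)[OF assms] .
  also have "\<dots> = Suc (level (y - x))"
    using assms by (intro level_double) (auto simp: progression_def)
  finally show "level (z - x) = Suc (level (y - x))" .
qed

lemma level_diff_commute: "level (x - y) = level (y - x)"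
  using level_minus[of "x - y"] by simp

text \<open>With L the level of the difference, the inner edges contribute 4 L, the outer edge 2 (L
  + 1), and the diagonal the constant \<open>3 * level 0\<close>, which cancels in
  comparisons.\<close>

lemma face_level_progression:
  assumes "progression x y z"
  shows "face_level {x, y, z} = 3 * level 0 + 6 * level (y - x) + 2"
proof -
  have ne: "x \<noteq> y" "y \<noteq> z" "x \<noteq> z" using progressionD[OF assms] by auto
  have "face_level {x, y, z} =
      3 * level 0 + (level (x - y) + level (y - x)) + (level (x - z) + level (z - x))
        + (level (y - z) + level (z - y))"
    unfolding face_level_def using ne by simp
  then show ?thesis
    using level_progression[OF assms] level_diff_commute[of x y] level_diff_commute[of x z]
      level_diff_commute[of y z] by simp
qed

text \<open>The outer edge of the first face must be an inner edge of the second, whose difference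
  is then twice the first up to sign and so one level higher.\<close>

lemma face_level_less:
  assumes p: "progression x y z" and q: "progression x' y' z'"
    and sub: "{x, z} \<subseteq> {x', y', z'}" and ne: "{x', y', z'} \<noteq> {x, y, z}"
  shows "face_level {x, y, z} < face_level {x', y', z'}"
proof -
  \<comment> \<open>Otherwise both progressions would have the same midpoint, as 2 is invertible,
    and the faces would coincide.\<close>
  have "\<not> {x, z} \<subseteq> {x', z'}"
  proof
    assume "{x, z} \<subseteq> {x', z'}"
    then have eq: "x = x' \<and> z = z' \<or> x = z' \<and> z = x'" using progressionD(6)[OF p] by auto
    then have "N dvd x + z - 2 * y'" using q by (auto simp: progression_def add.commute)
    moreover have "N dvd x + z - 2 * y" using p by (simp add: progression_def)
    ultimately have "N dvd (x + z - 2 * y') - (x + z - 2 * y)" by (rule dvd_diff)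
    moreover have "(x + z - 2 * y') - (x + z - 2 * y) = 2 * (y - y')" by simp
    ultimately have "N dvd y - y'" by (simp only: dvd_2_times)
    then have "y = y'" using dvd_diff_iff_eq progressionD(2) p q by blast
    then have "{x', y', z'} = {x, y, z}" using eq by auto
    then show False using ne by contradiction
  qed
  then have "y' = x \<or> y' = z" using sub by auto
  then have "x = y' \<and> (z = x' \<or> z = z') \<or> z = y' \<and> (x = x' \<or> x = z')"
    using sub progressionD(6)[OF p] by auto
  then have "level (z - x) = level (y' - x')"
    using level_progression(1)[OF q] level_diff_commute by metis
  then have "level (y - x) < level (y' - x')" using level_progression(2)[OF p] by simp
  then show ?thesis by (simp only: face_level_progression[OF p] face_level_progression[OF q])
qed

lemma collapsible_AP_complex: "collapsible 2 (AP_complex n)"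
proof (rule collapsible_by_level[where lev = face_level])
  show "finite (faces 2 (AP_complex n))" by (simp add: faces_AP_complex finite_AP_faces)
  fix \<sigma> assume "\<sigma> \<in> faces 2 (AP_complex n)"
  then obtain x y z where \<sigma>: "\<sigma> = {x, y, z}" and p: "progression x y z"
    by (auto simp: faces_AP_complex AP_faces_eq)
  \<comment> \<open>The facet to collapse along is the outer edge, which belongs to the full
    1-skeleton.\<close>
  have "{x, z} \<in> AP_complex n" "card {x, z} = 2"
    using progressionD[OF p] by (simp_all add: AP_complex_def carrier_Zmod)
  moreover have "face_level \<sigma> < face_level \<sigma>'"
    if "\<sigma>' \<in> faces 2 (AP_complex n)" "{x, z} \<subseteq> \<sigma>'" "\<sigma>' \<noteq> \<sigma>" for \<sigma>'
  proof -
    from that(1) obtain x' y' z' where \<sigma>': "\<sigma>' = {x', y', z'}" and q: "progression x' y' z'"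
      unfolding faces_AP_complex AP_faces_eq by blast
    show ?thesis using face_level_less[OF p q] that(2,3) unfolding \<sigma> \<sigma>' by blast
  qed
  moreover have "{x, z} \<subseteq> \<sigma>" using \<sigma> by blast
  ultimately show "\<exists>\<tau>\<in>AP_complex n. card \<tau> = 2 \<and> \<tau> \<subseteq> \<sigma> \<and>
      (\<forall>\<sigma>'\<in>faces 2 (AP_complex n). \<tau> \<subseteq> \<sigma>' \<longrightarrow> \<sigma>' \<noteq> \<sigma> \<longrightarrow> face_level \<sigma> < face_level \<sigma>')"
    by blast
qed

section \<open>Counting the progressions\<close>

text \<open>A face is determined by its middle term and its difference up to sign. For
  \<open>n = 2 * p + 1\<close> the differences can be taken from 2 to \<open>p\<close>, giving
  \<open>n * (p - 1)\<close> faces.\<close>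

lemma card_AP_faces: "card (AP_faces n) + 1 = (n - 1) choose 2"
proof -
  have "odd n" using prime_n n_ge_5 by (simp add: prime_odd_nat)
  then obtain p where n: "n = 2 * p + 1" by (rule oddE)
  have N: "N = 2 * int p + 1" using n by simp
  have p2: "p \<ge> 2" using n n_ge_5 by simp
  define g where "g = (\<lambda>(y, d). {(y - d) mod N, y, (y + d) mod N})"
  have N0: "N > 0" using n_ge_5 by simp
  have mod_dvd: "N dvd a mod N - a" for a by (simp add: mod_eq_dvd_iff[symmetric])
  have prog: "progression ((y - d) mod N) y ((y + d) mod N)"
    if y: "y \<in> {0..<N}" and d: "d \<in> {2..int p}" for y d
  proof -
    have 1: "N dvd (y - d) mod N - (y - d)" and 2: "N dvd (y + d) mod N - (y + d)"
      by (rule mod_dvd)+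
    have "N dvd - ((y - d) mod N - (y - d))" using 1 by (simp only: dvd_minus_iff)
    then have diff: "N dvd (y - (y - d) mod N) - d" by (simp add: algebra_simps)
    note shift = dvd_add_cong[OF diff]
    have "N dvd ((y - d) mod N - (y - d)) + ((y + d) mod N - (y + d))"
      using 1 2 by (rule dvd_add)
    then have "N dvd (y - d) mod N + (y + d) mod N - 2 * y" by (simp add: algebra_simps)
    \<comment> \<open>As \<open>d\<close> is between 2 and \<open>p\<close>, the numbers
      \<open>d - 1\<close>, \<open>d\<close> and \<open>d + 1\<close> all lie strictly between 0 and
      \<open>N\<close>.\<close>
    moreover have "\<not> N dvd y - (y - d) mod N"
      using shift[of 0] d N zdvd_not_zless[of d N] by simp
    moreover have "\<not> N dvd y - (y - d) mod N - 1"
      using shift[of "- 1"] d N zdvd_not_zless[of "d - 1" N] by simp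
    moreover have "\<not> N dvd y - (y - d) mod N + 1"
      using shift[of 1] d N zdvd_not_zless[of "d + 1" N] by simp
    ultimately show "progression ((y - d) mod N) y ((y + d) mod N)"
      using y N0 by (auto simp: progression_def)
  qed
  have inj: "inj_on g ({0..<N} \<times> {2..int p})"
  proof (rule inj_onI, clarify)
    fix y d y' d'
    assume y: "y \<in> {0..<N}" and d: "d \<in> {2..int p}" and y': "y' \<in> {0..<N}" and d': "d' \<in> {2..int p}"
      and eq: "g (y, d) = g (y', d')"
    note P = prog[OF y d] and Q = prog[OF y' d']
    have eq': "{(y - d) mod N, y, (y + d) mod N} = {(y' - d') mod N, y', (y' + d') mod N}"
      using eq by (simp add: g_def)
    then have yy: "y' = y" using progression_middle_unique[OF P Q] by simp
    have "(y - d) mod N \<in> {(y' - d') mod N, y', (y' + d') mod N}" using eq' by blast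
    then have "(y - d) mod N = (y - d') mod N \<or> (y - d) mod N = (y + d') mod N"
      using progressionD(4)[OF P] yy by simp
    then have "d = d'"
    proof
      assume "(y - d) mod N = (y - d') mod N"
      then have "N dvd d' - d" by (simp add: mod_eq_dvd_iff)
      then show "d = d'" using dvd_diff_iff_eq[of d' d] d d' N by simp
    next
      assume "(y - d) mod N = (y + d') mod N"
      \<comment> \<open>Opposite differences cannot both be in range, since
        \<open>0 < d + d'\<close> and \<open>d + d' \<le> 2 * p < N\<close>.\<close>
      then have "N dvd - (d + d')" by (simp add: mod_eq_dvd_iff algebra_simps)
      then show "d = d'" using zdvd_not_zless[of "d + d'" N] d d' N by (simp only: dvd_minus_iff) simp
    qed
    then show "y = y' \<and> d = d'" using yy by simp
  qed
  have "g ` ({0..<N} \<times> {2..int p}) = AP_faces n"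
  proof (intro equalityI subsetI)
    fix \<sigma> assume "\<sigma> \<in> g ` ({0..<N} \<times> {2..int p})"
    then obtain y d where "\<sigma> = {(y - d) mod N, y, (y + d) mod N}" "y \<in> {0..<N}" "d \<in> {2..int p}"
      by (auto simp: g_def)
    then show "\<sigma> \<in> AP_faces n" using prog unfolding AP_faces_eq by blast
  next
    have *: "{x, y, z} \<in> g ` ({0..<N} \<times> {2..int p})"
      if P: "progression x y z" and le: "(y - x) mod N \<le> int p" for x y z
    proof -
      define d where "d = (y - x) mod N"
      have dd: "N dvd d - (y - x)" unfolding d_def by (rule mod_dvd)
      note shift = dvd_add_cong[OF dd]
      have "d \<ge> 0" "d \<noteq> 0" "d \<noteq> 1"
        using N0 P shift[of 0] shift[of "- 1"] by (auto simp: d_def progression_def)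
      then have d: "d \<in> {2..int p}" using le d_def by simp
      have "N dvd - (d - (y - x))" using dd by (simp only: dvd_minus_iff)
      then have "(y - d) mod N = x mod N" by (simp add: mod_eq_dvd_iff algebra_simps)
      moreover have "N dvd (d - (y - x)) - ((z - y) - (y - x))"
        using dd progressionD(8)[OF P] by (rule dvd_diff)
      then have "(y + d) mod N = z mod N" by (simp add: mod_eq_dvd_iff algebra_simps)
      ultimately have "g (y, d) = {x, y, z}" using progressionD(1,3)[OF P] by (simp add: g_def)
      then show ?thesis using d progressionD(2)[OF P] by (metis SigmaI imageI)
    qed
    fix \<sigma> assume "\<sigma> \<in> AP_faces n"
    then obtain x y z where \<sigma>: "\<sigma> = {x, y, z}" and P: "progression x y z"
      by (auto simp: AP_faces_eq)
    show "\<sigma> \<in> g ` ({0..<N} \<times> {2..int p})"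
    proof (cases "(y - x) mod N \<le> int p")
      case True
      then show ?thesis using *[OF P] \<sigma> by simp
    next
      \<comment> \<open>Read backwards, the progression has difference
        \<open>N - (y - x) mod N\<close>, which is at most \<open>p\<close>.\<close>
      case False
      have "N dvd (z - y) - (y - x)" by (rule progressionD(8)[OF P])
      then have "N dvd - ((z - y) - (y - x))" by (simp only: dvd_minus_iff)
      then have "(y - z) mod N = (- (y - x)) mod N" by (simp add: mod_eq_dvd_iff algebra_simps)
      also have "\<dots> = N - (y - x) mod N"
        using progressionD(7)[OF P] by (simp only: zmod_zminus1_eq_if mod_eq_0_iff_dvd if_False)
      finally have "(y - z) mod N \<le> int p" using False N by simp
      then have "{z, y, x} \<in> g ` ({0..<N} \<times> {2..int p})" using *[OF progression_sym[OF P]] by simp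
      moreover have "{z, y, x} = {x, y, z}" by auto
      ultimately show ?thesis using \<sigma> by simp
    qed
  qed
  then have "card (AP_faces n) = card ({0..<N} \<times> {2..int p})"
    using card_image[OF inj] by simp
  also have "\<dots> = n * (p - 1)" using p2 by (simp add: card_cartesian_product nat_diff_distrib)
  also have "\<dots> = (2 * p + 1) * (p - 1)" by (simp only: n)
  finally have "card (AP_faces n) = (2 * p + 1) * (p - 1)" .
  moreover have "(n - 1) choose 2 = p * (2 * p - 1)" using n by (simp add: choose_two)
  \<comment> \<open>Writing \<open>p\<close> as a successor removes the truncated
    subtractions.\<close>
  moreover obtain q where "p = Suc q" using p2 by (cases p) auto
  ultimately show ?thesis by (simp add: algebra_simps)
qed

section \<open>The rational shadow\<close>

text \<open>This is the coboundary of the cochain sending an oriented edge \<open>(u, v)\<close> to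
  \<open>lift (v - u)\<close>, evaluated on the oriented triangle \<open>(x, y, z)\<close>.\<close>

definition lift_sum :: "int \<Rightarrow> int \<Rightarrow> int \<Rightarrow> int" where
  "lift_sum x y z = lift (y - x) + lift (z - y) + lift (x - z)"

lemma not_dvd_diff:
  assumes "x \<in> {0..<N}" "y \<in> {0..<N}" "x \<noteq> y"
  shows "\<not> N dvd x - y"
  using assms dvd_diff_iff_eq by blast

lemma lift_sum_rotate: "lift_sum y z x = lift_sum x y z"
  by (simp add: lift_sum_def)

lemma lift_sum_progression:
  assumes p: "progression x y z"
  shows "lift_sum x y z = 0"
proof -
  note P = progressionD[OF p]
  have "\<not> N dvd z - y" "\<not> N dvd z - x" using P not_dvd_diff by simp_all
  then have "lift (z - y) = lift (y - x)" "lift (z - x) = lift (2 * (y - x))"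
    using lift_cong P(8,9) by blast+
  moreover have "lift (2 * (y - x)) = 2 * lift (y - x)"
    using p by (intro lift_double) (simp_all add: progression_def)
  moreover have "lift (x - z) = - lift (z - x)" using lift_minus[of "z - x"] \<open>\<not> N dvd z - x\<close> by simp
  ultimately show ?thesis by (simp add: lift_sum_def)
qed

text \<open>Two of the three lifts agree, and the vertex shared by the corresponding differences is
  the middle term.\<close>

lemma progression_of_lift_sum:
  assumes "x \<in> {0..<N}" "y \<in> {0..<N}" "z \<in> {0..<N}" "x \<noteq> y" "y \<noteq> z" "x \<noteq> z"
    and "lift_sum x y z = 0"
  shows "progression x y z \<or> progression y z x \<or> progression z x y"
proof -
  have nd: "\<not> N dvd y - x" "\<not> N dvd z - y" "\<not> N dvd x - z"
    using not_dvd_diff assms(1-6) by simp_all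
  have sum: "lift (y - x) + lift (z - y) + lift (x - z) = 0"
    using assms(7) by (simp add: lift_sum_def)
  have mid: "N dvd a + c - 2 * b" if "N dvd (b - a) - (c - b)" for a b c
    using dvd_minus_iff[of N "(b - a) - (c - b)"] that by (simp add: algebra_simps)
  consider "lift (y - x) = lift (z - y)" | "lift (z - y) = lift (x - z)" | "lift (x - z) = lift (y - x)"
    using zero_sum_of_powers_of_two[OF abs_lift abs_lift abs_lift sum] by metis
  then show ?thesis
  proof cases
    case 1
    then show ?thesis
      using lift_eq_sum[OF nd(1,2,3)] sum nd(1) mid[of y x z] assms(1-3) by (simp add: progression_def)
  next
    case 2
    then show ?thesis
      using lift_eq_sum[OF nd(2,3,1)] sum nd(2) mid[of z y x] assms(1-3) by (simp add: progression_def)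
  next
    case 3
    then show ?thesis
      using lift_eq_sum[OF nd(3,1,2)] sum nd(3) mid[of x z y] assms(1-3) by (simp add: progression_def)
  qed
qed

text \<open>A face may be listed in any order: rotation of \<open>lift_sum\<close> brings the middle
  term into second place, and \<open>progression_sym\<close> covers the two orders of the outer
  terms.\<close>

lemma lift_sum_eq_0_iff:
  assumes "x \<in> {0..<N}" "y \<in> {0..<N}" "z \<in> {0..<N}" "x \<noteq> y" "y \<noteq> z" "x \<noteq> z"
  shows "lift_sum x y z = 0 \<longleftrightarrow> {x, y, z} \<in> AP_faces n"
proof
  assume "lift_sum x y z = 0"
  then have "progression x y z \<or> progression y z x \<or> progression z x y"
    using progression_of_lift_sum assms by blast
  moreover have "{y, z, x} = {x, y, z}" "{z, x, y} = {x, y, z}" by auto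
  ultimately show "{x, y, z} \<in> AP_faces n" unfolding AP_faces_eq by blast
next
  assume "{x, y, z} \<in> AP_faces n"
  then obtain a b c where eq: "{x, y, z} = {a, b, c}" and p: "progression a b c"
    unfolding AP_faces_eq by blast
  have 0: "lift_sum a b c = 0" "lift_sum c b a = 0"
    using lift_sum_progression p progression_sym by blast+
  have "b \<in> {x, y, z}" using eq by simp
  then consider "b = x" | "b = y" | "b = z" by blast
  then show "lift_sum x y z = 0"
  proof cases
    case 1
    have "{a, c} = {a, b, c} - {b}" "{y, z} = {x, y, z} - {x}"
      using progressionD[OF p] assms by auto
    then have "{a, c} = {y, z}" using eq 1 by metis
    then have "lift_sum z x y = 0" using 0 1 by (auto simp: doubleton_eq_iff)
    then show ?thesis using lift_sum_rotate by metis
  next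
    case 2
    have "{a, c} = {a, b, c} - {b}" "{x, z} = {x, y, z} - {y}"
      using progressionD[OF p] assms by auto
    then have "{a, c} = {x, z}" using eq 2 by metis
    then show ?thesis using 0 2 by (auto simp: doubleton_eq_iff)
  next
    case 3
    have "{a, c} = {a, b, c} - {b}" "{x, y} = {x, y, z} - {z}"
      using progressionD[OF p] assms by auto
    then have "{a, c} = {x, y}" using eq 3 by metis
    then have "lift_sum y z x = 0" using 0 3 by (auto simp: doubleton_eq_iff)
    then show ?thesis using lift_sum_rotate by metis
  qed
qed

text \<open>\<open>Max\<close> and \<open>Min\<close> recover the orientation of an edge.\<close>

definition pairing :: "(int set \<Rightarrow> rat) \<Rightarrow> rat" where
  "pairing c = (\<Sum>\<tau> | \<tau> \<subseteq> {0..<N} \<and> card \<tau> = 2. c \<tau> * of_int (lift (Max \<tau> - Min \<tau>)))"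

text \<open>The edge \<open>{x, z}\<close> enters with sign -1, and oddness of \<open>lift\<close>
  turns this into the cyclic term \<open>lift (x - z)\<close>.\<close>

lemma pairing_boundary_column:
  assumes "x < y" "y < z" "{x, y, z} \<subseteq> {0..<N}"
  shows "pairing (boundary_column {x, y, z}) = of_int (lift_sum x y z)"
proof -
  let ?E = "{\<tau>. \<tau> \<subseteq> {0..<N} \<and> card \<tau> = 2}"
  let ?w = "\<lambda>\<tau>. of_int (lift (Max \<tau> - Min \<tau>)) :: rat"
  have fin: "finite ?E" by (rule finite_subset[of _ "Pow {0..<N}"]) auto
  have single: "(\<Sum>\<tau>\<in>?E. of_bool (\<tau> = {u, v}) * ?w \<tau>) = of_int (lift (v - u))"
    if "u < v" "u \<in> {0..<N}" "v \<in> {0..<N}" for u v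
  proof -
    have "{u, v} \<in> ?E" using that by auto
    have "(\<Sum>\<tau>\<in>?E. of_bool (\<tau> = {u, v}) * ?w \<tau>) = (\<Sum>\<tau>\<in>?E. if \<tau> = {u, v} then ?w \<tau> else 0)"
      by (intro sum.cong) auto
    also have "\<dots> = ?w {u, v}" using fin \<open>{u, v} \<in> ?E\<close> by (simp only: sum.delta if_True)
    finally show ?thesis using that(1) by (simp add: max_def min_def)
  qed
  have "pairing (boundary_column {x, y, z}) =
      (\<Sum>\<tau>\<in>?E. of_bool (\<tau> = {y, z}) * ?w \<tau>) - (\<Sum>\<tau>\<in>?E. of_bool (\<tau> = {x, z}) * ?w \<tau>)
        + (\<Sum>\<tau>\<in>?E. of_bool (\<tau> = {x, y}) * ?w \<tau>)"
    unfolding pairing_def boundary_column_triangle[OF assms(1,2)]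
    by (simp only: left_diff_distrib distrib_right sum_subtractf sum.distrib)
  also have "\<dots> = of_int (lift (z - y)) - of_int (lift (z - x)) + of_int (lift (y - x))"
    using assms by (simp only: single insert_subset less_trans[OF assms(1,2)])
  also have "lift (z - x) = - lift (x - z)"
    using lift_minus[of "x - z"] not_dvd_diff[of x z] assms by simp
  finally show ?thesis by (simp add: lift_sum_def)
qed

text \<open>Characteristic zero matters here: a nonzero integer \<open>lift_sum\<close> stays
  nonzero as a rational.\<close>

lemma pairing_eq_0_iff:
  assumes "\<sigma> \<in> simplices 2 {0..<N}"
  shows "pairing (boundary_column \<sigma>) = 0 \<longleftrightarrow> \<sigma> \<in> AP_faces n"
proof -
  obtain x y z where \<sigma>: "\<sigma> = {x, y, z}" "x < y" "y < z" "x \<in> {0..<N}" "y \<in> {0..<N}" "z \<in> {0..<N}"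
    using assms by (rule simplices_2_sorted)
  have "lift_sum x y z = 0 \<longleftrightarrow> \<sigma> \<in> AP_faces n"
    unfolding \<sigma>(1) using \<sigma>(2-6) by (intro lift_sum_eq_0_iff) simp_all
  moreover have "pairing (boundary_column \<sigma>) = of_int (lift_sum x y z)"
    unfolding \<sigma>(1) using \<sigma>(2-6) by (intro pairing_boundary_column) simp_all
  ultimately show ?thesis by simp
qed

text \<open>The kernel of \<open>pairing\<close> is a subspace containing the column of every face.
  The column of any other triangle lies outside it, hence outside the span, and so raises the
  rank.\<close>

lemma shadow_AP_faces: "shadow TYPE(rat) {0..<N} 2 (AP_faces n) = {}"
proof -
  have "chain.subspace {c. pairing c = 0}"
    by (auto simp: chain.subspace_def chain_scale_def pairing_def distrib_right sum.distrib
        mult.assoc sum_distrib_left[symmetric])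
  moreover have "(boundary_column :: int set \<Rightarrow> int set \<Rightarrow> rat) ` AP_faces n \<subseteq> {c. pairing c = 0}"
    using pairing_eq_0_iff AP_faces_subset by blast
  ultimately have span: "chain.span ((boundary_column :: int set \<Rightarrow> int set \<Rightarrow> rat) ` AP_faces n)
      \<subseteq> {c. pairing c = 0}"
    by (rule chain.span_minimal[rotated])
  have "simplex_rank TYPE(rat) (insert \<sigma> (AP_faces n)) \<noteq> simplex_rank TYPE(rat) (AP_faces n)"
    if "\<sigma> \<in> simplices 2 {0..<N}" "\<sigma> \<notin> AP_faces n" for \<sigma>
  proof -
    have "pairing (boundary_column \<sigma>) \<noteq> 0" using pairing_eq_0_iff that by blast
    then have "(boundary_column \<sigma> :: int set \<Rightarrow> rat) \<notin> chain.span (boundary_column ` AP_faces n)"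
      using span by blast
    from simplex_rank_insert[OF finite_AP_faces this] show ?thesis by simp
  qed
  then show ?thesis unfolding shadow_def by blast
qed

section \<open>The almost-hypertree and its complement\<close>

lemma almost_hypertree_AP_faces: "almost_hypertree TYPE('f::field) {0..<N} 2 (AP_faces n)"
proof -
  have "simplex_rank TYPE('f) (AP_faces n) = card (AP_faces n)"
    using simplex_rank_collapsible[OF collapsible_AP_complex, where 'f = 'f] finite_AP_faces
    by (simp add: faces_AP_complex)
  then show ?thesis
    using AP_faces_subset card_AP_faces by (simp add: almost_hypertree_def acyclic_set_def)
qed

text \<open>Pascal's rule makes the number of all triangles at least
  \<open>(n - 1) choose 2\<close>, which exceeds the number of faces. This supplies the simplex
  outside the complex that the hypercut argument uses.\<close>

lemma AP_faces_ne_simplices: "AP_faces n \<noteq> simplices 2 {0..<N}"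
proof
  assume eq: "AP_faces n = simplices 2 {0..<N}"
  have "simplices 2 {0..<N} = {\<sigma>. \<sigma> \<subseteq> {0..<N} \<and> card \<sigma> = 3}"
    by (auto simp: simplices_def faces_def intro: finite_subset)
  then have "card (AP_faces n) = n choose 3" using eq n_subsets[of "{0..<N}" 3] by simp
  moreover have "n choose 3 = ((n - 1) choose 2) + ((n - 1) choose 3)"
    using binomial_Suc_Suc[of "n - 1" 2] n_ge_5 by (simp add: numeral_3_eq_3 numeral_2_eq_2)
  ultimately show False using card_AP_faces by simp
qed

end

theorem theorem1:
  fixes n :: nat
  assumes "n \<ge> 5"
    and "prime n"
    and "generate (units_of (Zmod n))
           {\<ominus>\<^bsub>Zmod n\<^esub> \<one>\<^bsub>Zmod n\<^esub>, \<one>\<^bsub>Zmod n\<^esub> \<oplus>\<^bsub>Zmod n\<^esub> \<one>\<^bsub>Zmod n\<^esub>}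
         = carrier (units_of (Zmod n))"
  shows "collapsible 2 (AP_complex n)
    \<and> almost_hypertree TYPE('f::field) (carrier (Zmod n)) 2 (faces 2 (AP_complex n))
    \<and> shadow TYPE(rat) (carrier (Zmod n)) 2 (faces 2 (AP_complex n)) = {}
    \<and> perfect_hypercut TYPE(rat) (carrier (Zmod n))
        (simplices 2 (carrier (Zmod n)) - faces 2 (AP_complex n))"
proof -
  interpret residues_prime n "Zmod n"
    unfolding Zmod_def by unfold_locales (rule assms(2))
  \<comment> \<open>A nonzero residue modulo a prime is a unit, hence generated by -1 and 2; the
    exponent found for the remainder of \<open>d\<close> also serves \<open>d\<close>.\<close>
  have "\<exists>k>0. int n dvd d - 2 ^ k \<or> int n dvd d + 2 ^ k" if "\<not> int n dvd d" for d
  proof -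
    have "coprime d (int n)" using that p_coprime_right_int[of d] by blast
    then have "d mod int n \<in> carrier (units_of (Zmod n))"
      unfolding units_of_carrier by (rule mod_in_res_units[OF m_gt_one])
    then have "d mod int n \<in> generate (units_of (Zmod n))
        {\<ominus>\<^bsub>Zmod n\<^esub> \<one>\<^bsub>Zmod n\<^esub>, \<one>\<^bsub>Zmod n\<^esub> \<oplus>\<^bsub>Zmod n\<^esub> \<one>\<^bsub>Zmod n\<^esub>}"
      by (simp only: assms(3))
    then have "\<exists>k>0. int n dvd d mod int n - 2 ^ k \<or> int n dvd d mod int n + 2 ^ k"
      using assms(1) by (intro generate_power_of_two) simp_all
    moreover have "int n dvd d - d mod int n" by (simp add: dvd_minus_mod)
    then have "int n dvd (d - d mod int n) + c \<longleftrightarrow> int n dvd c" for c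
      by (simp only: dvd_add_right_iff)
    from this[of "d mod int n - 2 ^ _"] this[of "d mod int n + 2 ^ _"]
    have "int n dvd d - 2 ^ k \<longleftrightarrow> int n dvd d mod int n - 2 ^ k"
      and "int n dvd d + 2 ^ k \<longleftrightarrow> int n dvd d mod int n + 2 ^ k" for k
      by simp_all
    ultimately show ?thesis by (simp only:)
  qed
  then interpret two_generates n
    using assms(1,2) by unfold_locales
  have "perfect_hypercut TYPE(rat) {0..<int n} (simplices 2 {0..<int n} - AP_faces n)"
    by (rule perfect_hypercut_Diff[OF finite_atLeastLessThan_int almost_hypertree_AP_faces
          shadow_AP_faces AP_faces_ne_simplices])
  then show ?thesis
    unfolding faces_AP_complex carrier_Zmod
    by (intro conjI collapsible_AP_complex almost_hypertree_AP_faces shadow_AP_faces)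
qed

end
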